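(* Let $(u_h,q_h,p_h)\in (W_h^k)^3$ (depending on time $t$) satisfy, for every $t$, $$(q_h,v)+(u_h,v_x)-\langle \widehat{u}_h, v n\rangle = 0 \quad \text{for all } v\in W_h^k,$$ $$(p_h,z)+\varepsilon (q_h,z_x)-\varepsilon\langle \widehat{q}_h, z n\rangle = (f(u_h),z)\quad \text{for all } z\in W_h^k,$$ $$(u_{ht},w)-(p_h,w_x)+\langle \widehat{p}_h, w n\rangle = 0\quad \text{for all } w\in W_h^k,$$ where the numerical traces are defined at every node by $$\widehat{u}_h=\{u_h\},\qquad \widehat{q}_h=\{q_h\}+\tau_{qu}[\![u_h]\!],\qquad \widehat{p}_h=\{p_h\}+\tau_{pu}[\![u_h]\!],$$ and where the penalization parameters $\tau_{qu},\tau_{pu}$ (constant in $x$, i.e. the same at all nodes) satisfy, for every $t$, $$\tau_{pu}\sum_{i=1}^N [\![u_h]\!]^2(x_i)-\varepsilon\tau_{qu}\sum_{i=1}^N\big([\![u_h]\!][\![q_h]\!]\big)(x_i)=\sum_{i=1}^N\Big([\![V(u_h)]\!]-\{\Pi f(u_h)\}[\![u_h]\!]\Big)(x_i),$$ $$\tau_{pu}\sum_{i=1}^N\big([\![p_h]\!][\![u_h]\!]\big)(x_i)+\varepsilon\tau_{qu}\sum_{i=1}^N\big([\![u_h]\!]_t[\![u_h]\!]\big)(x_i)=0.$$ Then the mass, the $L^2$-energy and the Hamiltonian are conserved: $$\frac{d}{dt}\int_{\mathcal{T}_h}u_h\,dx=0,\qquad \frac{d}{dt}\int_{\mathcal{T}_h}u_h^2\,dx=0,\qquad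 \frac{d}{dt}\int_{\mathcal{T}_h}\Big(\frac{\varepsilon}{2}q_h^2-V(u_h)\Big)dx=0.$$
   Context: The setting is a semi-discrete (continuous in time) discontinuous Galerkin method for the generalized KdV equation $u_t+\varepsilon u_{xxx}+f(u)_x=g$ on $\Omega=[a,b]$ with periodic boundary conditions, in the case $g=0$. Here $\varepsilon$ is a real constant, $f:\mathbb{R}\to\mathbb{R}$ is a given continuous function (typically a polynomial), and $V$ is an antiderivative of $f$. Mesh: $a=x_0<x_1<\dots<x_N=b$, $I_i=(x_{i-1},x_i)$, $\mathcal{T}_h=\{I_i\}_{i=1}^N$, and the set of nodes is $\mathcal{E}_h=\{x_i\}_{i=0}^N$. For a function $\zeta$ on the element boundaries, $\zeta(x_i^-)$ is its value at $x_i$ seen from $I_i$, and $\zeta(x_{i}^+)$ its value at $x_i$ seen from $I_{i+1}$; for a piecewise smooth function these are the left and right one-sided limits. Periodicity convention: the nodes $x_0$ and $x_N$ are identified, so $\zeta(x_N^+):=\zeta(x_0^+)$ and $\zeta(x_0^-):=\zeta(x_N^-)$. For an integer $k\ge 0$, $W_h^k=\{\omega\in L^2(\mathcal{T}_h): \omega|_{I_i}\text{ is a polynomial of degree at most }k\text{ for each } i\}$, with functions regarded as periodic in the sense that the nodes $x_0$ and $x_N$ are identified, i.e. $\omega(x_N^+):=\omega(x_0^+)$ and $\omega(x_0^-):=\omega(x_N^-)$. $\Pi$ denotes the $L^2$-orthogonal projection onto $W_h^k$. Notation: $(\varphi,v)=\sum_{i=1}^N\int_{I_i}\varphi v\,dx$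 (derivatives $v_x$ are taken elementwise); $\langle\varphi,vn\rangle=\sum_{i=1}^N\big(\varphi(x_i^-)v(x_i^-)-\varphi(x_{i-1}^+)v(x_{i-1}^+)\big)$, where $n$ is the outward unit normal ($n(x_i^-)=1$, $n(x_{i-1}^+)=-1$). $\{\varphi\}(x_i)=\tfrac12(\varphi(x_i^-)+\varphi(x_i^+))$ and $[\![\varphi]\!](x_i)=\varphi(x_i^-)-\varphi(x_i^+)$. A subscript $t$ denotes the time derivative (so $u_{ht}=\partial_t u_h$, $[\![u_h]\!]_t=\partial_t[\![u_h]\!]$), and $\int_{\mathcal{T}_h}=\sum_{i=1}^N\int_{I_i}$. All time-dependent quantities are assumed differentiable in $t$ whenever their time derivative is used. The parameters $\tau_{qu},\tau_{pu}$ may depend on $t$. *)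

theory Defs
  imports "HOL-Analysis.Analysis" "HOL-Computational_Algebra.Polynomial"
begin

definition mesh :: "real \<Rightarrow> real \<Rightarrow> nat \<Rightarrow> (nat \<Rightarrow> real) \<Rightarrow> bool" where
  "mesh a b N x \<longleftrightarrow> 1 \<le> N \<and> x 0 = a \<and> x N = b \<and> (\<forall>i<N. x i < x (Suc i))"

definition elem :: "(nat \<Rightarrow> real) \<Rightarrow> nat \<Rightarrow> real set" where
  "elem x i = {x (i - 1)<..<x i}"

text \<open>Functions on the mesh are total functions on the reals, of which only the values on the open
  elements matter: no notion below depends on the values at the nodes or outside the domain.
  In particular the members of the following space are square integrable on each element.\<close>

definition Wh :: "(nat \<Rightarrow> real) \<Rightarrow> nat \<Rightarrow> nat \<Rightarrow> (real \<Rightarrow> real) set" where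
  "Wh x N k = {\<omega>. \<forall>i\<in>{1..N}. \<exists>P :: real poly. degree P \<le> k \<and> (\<forall>y\<in>elem x i. \<omega> y = poly P y)}"

definition mesh_integral :: "(nat \<Rightarrow> real) \<Rightarrow> nat \<Rightarrow> (real \<Rightarrow> real) \<Rightarrow> real" where
  "mesh_integral x N \<phi> = (\<Sum>i=1..N. integral (elem x i) \<phi>)"

definition mesh_inner :: "(nat \<Rightarrow> real) \<Rightarrow> nat \<Rightarrow> (real \<Rightarrow> real) \<Rightarrow> (real \<Rightarrow> real) \<Rightarrow> real" where
  "mesh_inner x N \<phi> v = mesh_integral x N (\<lambda>y. \<phi> y * v y)"

text \<open>One-sided traces at the node \<open>x i\<close>, with the end nodes \<open>x 0\<close> and \<open>x N\<close> identified.\<close>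

definition trace_minus :: "(nat \<Rightarrow> real) \<Rightarrow> nat \<Rightarrow> (real \<Rightarrow> real) \<Rightarrow> nat \<Rightarrow> real" where
  "trace_minus x N \<zeta> i = Lim (at_left (x (if i = 0 then N else i))) \<zeta>"

definition trace_plus :: "(nat \<Rightarrow> real) \<Rightarrow> nat \<Rightarrow> (real \<Rightarrow> real) \<Rightarrow> nat \<Rightarrow> real" where
  "trace_plus x N \<zeta> i = Lim (at_right (x (if i = N then 0 else i))) \<zeta>"

definition avg :: "(nat \<Rightarrow> real) \<Rightarrow> nat \<Rightarrow> (real \<Rightarrow> real) \<Rightarrow> nat \<Rightarrow> real" where
  "avg x N \<phi> i = (trace_minus x N \<phi> i + trace_plus x N \<phi> i) / 2"

definition jump :: "(nat \<Rightarrow> real) \<Rightarrow> nat \<Rightarrow> (real \<Rightarrow> real) \<Rightarrow> nat \<Rightarrow> real" where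
  "jump x N \<phi> i = trace_minus x N \<phi> i - trace_plus x N \<phi> i"

text \<open>The pairing \<open>\<langle>\<phi>, v n\<rangle>\<close>, for \<open>\<phi>\<close> single-valued at the nodes (as numerical traces are), so that
  \<open>\<phi>\<close> has the same value \<open>\<phi> i\<close> from both sides of \<open>x i\<close>.\<close>

definition bdry :: "(nat \<Rightarrow> real) \<Rightarrow> nat \<Rightarrow> (nat \<Rightarrow> real) \<Rightarrow> (real \<Rightarrow> real) \<Rightarrow> real" where
  "bdry x N \<phi> v =
     (\<Sum>i=1..N. \<phi> i * trace_minus x N v i - \<phi> (i - 1) * trace_plus x N v (i - 1))"

text \<open>The \<open>L\<^sup>2\<close>-orthogonal projection onto \<open>Wh x N k\<close>. It is unique on the elements, but not at the
  nodes or outside the domain, whence the choice operator.\<close>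

definition L2_proj :: "(nat \<Rightarrow> real) \<Rightarrow> nat \<Rightarrow> nat \<Rightarrow> (real \<Rightarrow> real) \<Rightarrow> real \<Rightarrow> real" where
  "L2_proj x N k \<phi> =
     (SOME \<omega>. \<omega> \<in> Wh x N k \<and> (\<forall>v\<in>Wh x N k. mesh_inner x N \<omega> v = mesh_inner x N \<phi> v))"

text \<open>Time derivative on a time interval \<open>J\<close>; one-sided at an endpoint of \<open>J\<close> belonging to \<open>J\<close>.\<close>

definition tderiv :: "real set \<Rightarrow> (real \<Rightarrow> real) \<Rightarrow> real \<Rightarrow> real" where
  "tderiv J \<phi> t = vector_derivative \<phi> (at t within J)"

end

theory Submission
  imports Defs
begin

text \<open>
  The energy law follows by testing the third equation with \<open>u\<close>, the first with \<open>p\<close> and with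
  \<open>\<Pi> f(u)\<close>, and the second with \<open>q\<close>: after elementwise integration by parts everything cancels except
  the boundary terms that the first condition on the penalization parameters annihilates. The
  Hamiltonian law follows by testing the third equation with \<open>p\<close>, the second with \<open>u\<^sub>t\<close>, and the time
  derivative of the first with \<open>q\<close>; what remains is the second condition. Mass is the test function 1.

  Differentiability in time is only assumed pointwise in space. On each element a polynomial of
  bounded degree is determined by its values at finitely many fixed points, so the coefficients are
  differentiable, the traces can be differentiated, and difference quotients are bounded uniformly in
  space. As the time derivative need not be continuous, differentiation under the integral sign is
  then justified by dominated convergence.
\<close>

section \<open>Polynomials on an interval\<close>

text \<open>The basis depends on the nodes alone, so for a time-dependent polynomial all time
  dependence sits in finitely many nodal values. The identity holds because both sides have degree
  below \<open>card A\<close> and agree on \<open>A\<close>.\<close>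

lemma lagrange_basis:
  fixes A :: "'a::field set"
  assumes "finite A"
  obtains L where "\<And>p. degree p < card A \<Longrightarrow> p = (\<Sum>a\<in>A. smult (poly p a) (L a))"
    and "\<And>a. a \<in> A \<Longrightarrow> degree (L a) < card A"
proof -
  define L where "L a = (\<Prod>b\<in>A - {a}. smult (1 / (a - b)) [:- b, 1:])" for a
  have deg: "degree (L a) < card A" if "a \<in> A" for a
  proof -
    have "degree (L a) \<le> (\<Sum>b\<in>A - {a}. degree (smult (1 / (a - b)) [:- b, 1:]))"
      unfolding L_def using assms by (intro degree_prod_sum_le[unfolded o_def]) simp
    also have "\<dots> \<le> (\<Sum>b\<in>A - {a}. 1)"
      by (intro sum_mono order.trans[OF degree_smult_le]) simp
    also have "\<dots> < card A"
      using card_Diff1_less[OF assms that] by simp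
    finally show ?thesis .
  qed
  have at_node: "poly (L a) c = (if a = c then 1 else 0)" if "a \<in> A" "c \<in> A" for a c
    using assms that by (auto simp: L_def poly_prod simp flip: diff_divide_distrib)
  have "p = (\<Sum>a\<in>A. smult (poly p a) (L a))" if "degree p < card A" for p
  proof (rule poly_eqI_degree[of A])
    show "degree (\<Sum>a\<in>A. smult (poly p a) (L a)) < card A"
      using deg that by (intro degree_sum_less) (auto intro: le_less_trans[OF degree_smult_le])
  next
    fix c assume c: "c \<in> A"
    have "(\<Sum>a\<in>A. poly p a * poly (L a) c) = (\<Sum>a\<in>A. if a = c then poly p a else 0)"
      using at_node[OF _ c] by (intro sum.cong) auto
    then show "poly p c = poly (\<Sum>a\<in>A. smult (poly p a) (L a)) c"
      using assms c by (simp add: poly_sum)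
  qed (fact that)
  then show thesis using that deg by blast
qed

text \<open>A vanishing integral of a continuous nonnegative function would force infinitely many
  roots of \<open>E\<close>. This justifies the division in the orthogonalization step
  below.\<close>

lemma integral_poly_square_pos:
  fixes E :: "real poly"
  assumes "l < r" "E \<noteq> 0"
  shows "0 < integral {l..r} (\<lambda>y. poly E y * poly E y)"
proof -
  have "integral {l..r} (\<lambda>y. poly E y * poly E y) \<noteq> 0"
  proof
    assume "integral {l..r} (\<lambda>y. poly E y * poly E y) = 0"
    then have "\<forall>y\<in>{l..r}. poly E y * poly E y = 0"
      using assms by (subst (asm) integral_eq_0_iff) (auto intro!: continuous_intros)
    then have "{l..r} \<subseteq> {y. poly E y = 0}" by auto
    then show False
      using poly_roots_finite[OF assms(2)] infinite_Icc[OF assms(1)] finite_subset by blast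
  qed
  moreover have "0 \<le> integral {l..r} (\<lambda>y. poly E y * poly E y)"
    by (intro integral_nonneg integrable_continuous_real continuous_intros) auto
  ultimately show ?thesis by simp
qed

text \<open>One Gram-Schmidt step per degree: a monic \<open>E\<close> of degree
  \<open>Suc k\<close>, orthogonal to all lower degrees, is built, and a multiple of it is added to
  the projection of degree at most \<open>k\<close>.\<close>

lemma poly_L2_projection:
  fixes \<phi> :: "real \<Rightarrow> real"
  assumes lr: "l < r" and \<phi>: "continuous_on {l..r} \<phi>"
  shows "\<exists>P. degree P \<le> k \<and> (\<forall>v. degree v \<le> k \<longrightarrow>
    integral {l..r} (\<lambda>y. poly P y * poly v y) = integral {l..r} (\<lambda>y. \<phi> y * poly v y))"
  using \<phi>
proof (induction k arbitrary: \<phi>)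
  case 0
  \<comment> \<open>In degree 0 the projection is the mean value.\<close>
  let ?P = "[:integral {l..r} \<phi> / (r - l):]"
  have "integral {l..r} (\<lambda>y. poly ?P y * poly v y) = integral {l..r} (\<lambda>y. \<phi> y * poly v y)"
    if "degree v = 0" for v
    using that lr by (elim degree_eq_zeroE) simp
  then show ?case by (intro exI[of _ ?P]) auto
next
  case (Suc k)
  define I where "I f = integral {l..r} f" for f :: "real \<Rightarrow> real"
  obtain P where P: "degree P \<le> k"
    "\<And>v. degree v \<le> k \<Longrightarrow> I (\<lambda>y. poly P y * poly v y) = I (\<lambda>y. \<phi> y * poly v y)"
    using Suc unfolding I_def by blast
  \<comment> \<open>The induction hypothesis is used a second time, for the leading monomial instead
    of \<open>\<phi>\<close>; subtracting the result yields \<open>E\<close>.\<close>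
  have "\<exists>Q. degree Q \<le> k \<and> (\<forall>v. degree v \<le> k \<longrightarrow>
      I (\<lambda>y. poly Q y * poly v y) = I (\<lambda>y. poly (monom 1 (Suc k)) y * poly v y))"
    unfolding I_def by (intro Suc.IH continuous_intros)
  then obtain Q where Q: "degree Q \<le> k"
    "\<And>v. degree v \<le> k \<Longrightarrow> I (\<lambda>y. poly Q y * poly v y) = I (\<lambda>y. poly (monom 1 (Suc k)) y * poly v y)"
    by blast
  define E where "E = monom 1 (Suc k) - Q"
  have coeff_E: "coeff E (Suc k) = 1" and deg_E: "degree E \<le> Suc k"
    using Q(1) by (auto simp: E_def coeff_eq_0 intro!: degree_diff_le degree_monom_le)
  have int: "f integrable_on {l..r}" if "continuous_on {l..r} f" for f :: "real \<Rightarrow> real"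
    using that by (rule integrable_continuous_real)
  have E_orth: "I (\<lambda>y. poly E y * poly v y) = 0" if "degree v \<le> k" for v
    using Q(2)[OF that] unfolding I_def E_def
    by (simp add: left_diff_distrib integral_diff int continuous_intros)
  have E_pos: "0 < I (\<lambda>y. poly E y * poly E y)"
    unfolding I_def using lr coeff_E by (intro integral_poly_square_pos) auto
  define c where "c = I (\<lambda>y. \<phi> y * poly E y) / I (\<lambda>y. poly E y * poly E y)"
  have "I (\<lambda>y. poly (P + smult c E) y * poly v y) = I (\<lambda>y. \<phi> y * poly v y)"
    if v: "degree v \<le> Suc k" for v
  proof -
    define d where "d = coeff v (Suc k)"
    \<comment> \<open>Since \<open>E\<close> is monic, this removes the leading term of
      \<open>v\<close>, so \<open>P\<close> and the orthogonality of \<open>E\<close> apply to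
      \<open>w\<close>.\<close>
    define w where "w = v - smult d E"
    have v_eq: "v = w + smult d E" by (simp add: w_def)
    have w: "degree w \<le> k"
    proof (rule degree_le, intro allI impI)
      fix i assume "k < i"
      then consider "i = Suc k" | "Suc k < i" by linarith
      then show "coeff w i = 0"
        using v deg_E by cases (auto simp: w_def d_def coeff_E coeff_eq_0)
    qed
    have "I (\<lambda>y. poly (P + smult c E) y * poly v y) =
        I (\<lambda>y. poly P y * poly w y) + d * I (\<lambda>y. poly E y * poly P y)
        + c * I (\<lambda>y. poly E y * poly w y) + c * d * I (\<lambda>y. poly E y * poly E y)"
      unfolding v_eq I_def
      by (simp add: algebra_simps integral_add int continuous_intros flip: integral_mult_right)
    also have "\<dots> = I (\<lambda>y. \<phi> y * poly w y) + d * I (\<lambda>y. \<phi> y * poly E y)"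
      using E_pos w P by (simp add: E_orth c_def)
    also have "\<dots> = I (\<lambda>y. \<phi> y * poly v y)"
      unfolding v_eq I_def using Suc.prems
      by (simp add: algebra_simps integral_add int continuous_intros flip: integral_mult_right)
    finally show ?thesis .
  qed
  moreover have "degree (P + smult c E) \<le> Suc k"
    using P(1) deg_E by (intro degree_add_le) (auto intro: order.trans[OF degree_smult_le])
  ultimately show ?case unfolding I_def by blast
qed

section \<open>Differentiation under the integral sign\<close>

text \<open>The Lipschitz bound in time makes the constant \<open>C\<close> dominate the difference
  quotients along any sequence tending to \<open>t\<close>, so only pointwise convergence to
  \<open>G'\<close> is required, at the single time \<open>t\<close>.\<close>

lemma has_real_derivative_integral_dominated:
  fixes G :: "real \<Rightarrow> real \<Rightarrow> real"
  assumes deriv: "\<And>y. y \<in> S \<Longrightarrow> ((\<lambda>s. G s y) has_real_derivative G' y) (at t within J)"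
    and int: "\<And>s. G s integrable_on S" and const: "(\<lambda>_. C) integrable_on S"
    and lip: "\<forall>\<^sub>F s in at t within J. \<forall>y\<in>S. \<bar>G s y - G t y\<bar> \<le> C * \<bar>s - t\<bar>"
  shows "((\<lambda>s. integral S (G s)) has_real_derivative integral S G') (at t within J)"
  unfolding has_field_derivative_iff tendsto_at_iff_sequentially
proof (intro allI impI)
  fix X assume X: "\<forall>n. X n \<in> J - {t}" "X \<longlonglongrightarrow> t"
  then have X_at: "filterlim X (at t within J) sequentially"
    by (simp add: filterlim_at)
  \<comment> \<open>The bound holds only near \<open>t\<close>; the first \<open>m\<close> terms of
    the sequence are dropped and \<open>LIMSEQ_offset\<close> restores them at the end.\<close>
  then obtain m where m: "\<And>n y. n \<ge> m \<Longrightarrow> y \<in> S \<Longrightarrow> \<bar>G (X n) y - G t y\<bar> \<le> C * \<bar>X n - t\<bar>"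
    using lip unfolding filterlim_iff eventually_sequentially by blast
  let ?g = "\<lambda>n y. (G (X (n + m)) y - G t y) / (X (n + m) - t)"
  have "(\<lambda>n. integral S (?g n)) \<longlonglongrightarrow> integral S G'"
  proof (rule dominated_convergence(2)[OF _ const])
    show "?g n integrable_on S" for n
      using int by (intro integrable_on_divide integrable_diff)
    show "norm (?g n y) \<le> C" if "y \<in> S" for n y
      using m[of "n + m" y] that X(1) by (auto simp: field_simps)
    show "(\<lambda>n. ?g n y) \<longlonglongrightarrow> G' y" if "y \<in> S" for y
      using filterlim_compose[OF deriv[OF that, unfolded has_field_derivative_iff] X_at]
      by (rule LIMSEQ_ignore_initial_segment)
  qed
  also have "(\<lambda>n. integral S (?g n)) = (\<lambda>n.
      ((\<lambda>s. (integral S (G s) - integral S (G t)) / (s - t)) \<circ> X) (n + m))"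
    using int by (simp only: integral_divide integral_diff o_def)
  finally show "((\<lambda>s. (integral S (G s) - integral S (G t)) / (s - t)) \<circ> X) \<longlonglongrightarrow> integral S G'"
    by (rule LIMSEQ_offset)
qed

lemma has_real_derivative_locally_lipschitz:
  fixes c :: "real \<Rightarrow> real"
  assumes "(c has_real_derivative d) (at t within J)"
  shows "\<forall>\<^sub>F s in at t within J. \<bar>c s - c t\<bar> \<le> (\<bar>d\<bar> + 1) * \<bar>s - t\<bar>"
proof -
  have "((\<lambda>s. \<bar>(c s - c t) / (s - t)\<bar>) \<longlongrightarrow> \<bar>d\<bar>) (at t within J)"
    using assms unfolding has_field_derivative_iff by (rule tendsto_rabs)
  then have "\<forall>\<^sub>F s in at t within J. \<bar>(c s - c t) / (s - t)\<bar> < \<bar>d\<bar> + 1"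
    by (rule order_tendstoD) simp
  moreover have "\<forall>\<^sub>F s in at t within J. s \<noteq> t"
    by (simp add: eventually_at_filter)
  ultimately show ?thesis
    by eventually_elim (auto simp: field_simps)
qed

text \<open>Interpolation at \<open>Suc k\<close> fixed nodes turns pointwise differentiability into
  differentiability of the whole polynomial: \<open>P'\<close> interpolates the derivatives of the
  nodal values. The conclusion reaches every \<open>y\<close>, in particular the endpoints of the
  interval, where traces are taken.\<close>

lemma poly_family_has_derivative:
  fixes P :: "real \<Rightarrow> real poly"
  assumes t: "t \<in> J" and lr: "l < r" and deg: "\<And>s. s \<in> J \<Longrightarrow> degree (P s) \<le> k"
    and diff: "\<And>y. y \<in> {l<..<r} \<Longrightarrow> (\<lambda>s. poly (P s) y) differentiable (at t within J)"
  obtains P' C where "degree P' \<le> k"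
    and "\<And>y. ((\<lambda>s. poly (P s) y) has_real_derivative poly P' y) (at t within J)"
    and "\<forall>\<^sub>F s in at t within J. \<forall>y\<in>{l..r}. \<bar>poly (P s) y - poly (P t) y\<bar> \<le> C * \<bar>s - t\<bar>"
proof -
  \<comment> \<open>The nodes lie in the open interval because differentiability is assumed only
    there.\<close>
  obtain A where A: "finite A" "card A = Suc k" "A \<subseteq> {l<..<r}"
    using infinite_arbitrarily_large[OF infinite_Ioo[OF lr]] by blast
  obtain L where L: "\<And>p::real poly. degree p < card A \<Longrightarrow> p = (\<Sum>a\<in>A. smult (poly p a) (L a))"
    and deg_L: "\<And>a. a \<in> A \<Longrightarrow> degree (L a) < card A"
    using lagrange_basis[OF A(1)] by blast
  have P_eq: "poly (P s) y = (\<Sum>a\<in>A. poly (P s) a * poly (L a) y)" if "s \<in> J" for s y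
  proof -
    have "P s = (\<Sum>a\<in>A. smult (poly (P s) a) (L a))"
      using deg[OF that] A(2) by (intro L) simp
    then have "poly (P s) y = poly (\<Sum>a\<in>A. smult (poly (P s) a) (L a)) y" by simp
    then show ?thesis by (simp add: poly_sum)
  qed
  have "\<exists>d. \<forall>a\<in>A. ((\<lambda>s. poly (P s) a) has_real_derivative d a) (at t within J)"
    using diff A(3) by (intro bchoice) (auto simp: real_differentiable_def)
  then obtain d where d: "\<And>a. a \<in> A \<Longrightarrow> ((\<lambda>s. poly (P s) a) has_real_derivative d a) (at t within J)"
    by blast
  \<comment> \<open>Bounds on the basis polynomials over the compact interval carry the Lipschitz
    estimates from the nodes to all \<open>y\<close>.\<close>
  have "\<exists>B. \<forall>a\<in>A. \<forall>y\<in>{l..r}. \<bar>poly (L a) y\<bar> \<le> B a"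
  proof (intro bchoice ballI)
    fix a
    have "bounded ((\<lambda>y. poly (L a) y) ` {l..r})"
      by (intro compact_imp_bounded compact_continuous_image continuous_intros) auto
    then show "\<exists>B. \<forall>y\<in>{l..r}. \<bar>poly (L a) y\<bar> \<le> B"
      by (auto simp: bounded_iff)
  qed
  then obtain B where B: "\<And>a y. a \<in> A \<Longrightarrow> y \<in> {l..r} \<Longrightarrow> \<bar>poly (L a) y\<bar> \<le> B a" by blast
  show thesis
  proof
    show "degree (\<Sum>a\<in>A. smult (d a) (L a)) \<le> k"
      using A deg_L by (intro degree_sum_le) (fastforce intro: order.trans[OF degree_smult_le])+
    show "((\<lambda>s. poly (P s) y) has_real_derivative poly (\<Sum>a\<in>A. smult (d a) (L a)) y) (at t within J)"
      for y
    proof (rule has_field_derivative_transform_within[OF _ zero_less_one t])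
      show "((\<lambda>s. \<Sum>a\<in>A. poly (P s) a * poly (L a) y) has_real_derivative
          poly (\<Sum>a\<in>A. smult (d a) (L a)) y) (at t within J)"
        unfolding poly_sum poly_smult by (intro DERIV_sum DERIV_cmult_right d)
    qed (simp add: P_eq[symmetric])
    have "\<forall>\<^sub>F s in at t within J. \<forall>a\<in>A. \<bar>poly (P s) a - poly (P t) a\<bar> \<le> (\<bar>d a\<bar> + 1) * \<bar>s - t\<bar>"
      using A(1) d by (auto simp: eventually_ball_finite_distrib
          intro: has_real_derivative_locally_lipschitz)
    moreover have "\<forall>\<^sub>F s in at t within J. s \<in> J"
      by (simp add: eventually_at_filter)
    ultimately show "\<forall>\<^sub>F s in at t within J. \<forall>y\<in>{l..r}.
      \<bar>poly (P s) y - poly (P t) y\<bar> \<le> (\<Sum>a\<in>A. (\<bar>d a\<bar> + 1) * B a) * \<bar>s - t\<bar>"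
    proof eventually_elim
      case (elim s)
      show ?case
      proof
        fix y assume y: "y \<in> {l..r}"
        have "\<bar>poly (P s) y - poly (P t) y\<bar> = \<bar>\<Sum>a\<in>A. (poly (P s) a - poly (P t) a) * poly (L a) y\<bar>"
          using elim(2) t by (simp add: P_eq[of _ y] left_diff_distrib sum_subtractf)
        also have "\<dots> \<le> (\<Sum>a\<in>A. \<bar>(poly (P s) a - poly (P t) a) * poly (L a) y\<bar>)"
          by (rule sum_abs)
        also have "\<dots> \<le> (\<Sum>a\<in>A. ((\<bar>d a\<bar> + 1) * \<bar>s - t\<bar>) * B a)"
          using elim(1) B y unfolding abs_mult by (intro sum_mono mult_mono) auto
        also have "\<dots> = (\<Sum>a\<in>A. (\<bar>d a\<bar> + 1) * B a) * \<bar>s - t\<bar>"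
          by (simp add: sum_distrib_right sum_distrib_left mult_ac)
        finally show "\<bar>poly (P s) y - poly (P t) y\<bar> \<le> (\<Sum>a\<in>A. (\<bar>d a\<bar> + 1) * B a) * \<bar>s - t\<bar>" .
      qed
    qed
  qed
qed

text \<open>The chain rule under the integral sign. The nonlinearity \<open>F\<close> serves for
  squares and for \<open>V\<close>, the weight \<open>g\<close> for test functions.\<close>

lemma has_real_derivative_integral_poly_family:
  fixes P :: "real \<Rightarrow> real poly"
  assumes P': "\<And>y. ((\<lambda>s. poly (P s) y) has_real_derivative P' y) (at t within J)"
    and lip: "\<forall>\<^sub>F s in at t within J. \<forall>y\<in>{l..r}. \<bar>poly (P s) y - poly (P t) y\<bar> \<le> C * \<bar>s - t\<bar>"
    and F: "\<And>z. (F has_real_derivative F' z) (at z)" and F'_cont: "continuous_on UNIV F'"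
  shows "((\<lambda>s. integral {l..r} (\<lambda>y. F (poly (P s) y) * poly g y)) has_real_derivative
    integral {l..r} (\<lambda>y. F' (poly (P t) y) * P' y * poly g y)) (at t within J)"
proof -
  have bounded: "\<exists>B. \<forall>y\<in>{l..r}. \<bar>poly p y\<bar> \<le> B" for p :: "real poly"
  proof -
    have "bounded ((\<lambda>y. poly p y) ` {l..r})"
      by (intro compact_imp_bounded compact_continuous_image continuous_intros) auto
    then show ?thesis by (auto simp: bounded_iff)
  qed
  obtain B where B: "\<And>y. y \<in> {l..r} \<Longrightarrow> \<bar>poly (P t) y\<bar> \<le> B" using bounded by blast
  obtain Bg where Bg: "\<And>y. y \<in> {l..r} \<Longrightarrow> \<bar>poly g y\<bar> \<le> Bg" using bounded by blast
  \<comment> \<open>For times within distance 1 of \<open>t\<close>, the values of the family stay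
    within \<open>\<bar>C\<bar>\<close> of those at \<open>t\<close>, hence in this compact
    interval, on which \<open>F\<close> is Lipschitz with constant \<open>M\<close>.\<close>
  have "bounded (F' ` {-(B + \<bar>C\<bar>)..B + \<bar>C\<bar>})"
    using F'_cont by (intro compact_imp_bounded compact_continuous_image) (auto intro: continuous_on_subset)
  then have "\<exists>M. \<forall>z\<in>{-(B + \<bar>C\<bar>)..B + \<bar>C\<bar>}. \<bar>F' z\<bar> \<le> M"
    by (simp add: bounded_iff)
  then obtain M where M: "\<And>z. z \<in> {-(B + \<bar>C\<bar>)..B + \<bar>C\<bar>} \<Longrightarrow> \<bar>F' z\<bar> \<le> M"
    by blast
  have F_lip: "\<bar>F z - F w\<bar> \<le> M * \<bar>z - w\<bar>"
    if "z \<in> {-(B + \<bar>C\<bar>)..B + \<bar>C\<bar>}" "w \<in> {-(B + \<bar>C\<bar>)..B + \<bar>C\<bar>}" for z w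
    using field_differentiable_bound[of "{-(B + \<bar>C\<bar>)..B + \<bar>C\<bar>}" F F' M z w] that F M
    by (auto intro: has_field_derivative_at_within)
  have F_cont: "continuous_on UNIV F"
    using F by (meson DERIV_isCont continuous_at_imp_continuous_on)
  show ?thesis
  proof (rule has_real_derivative_integral_dominated[where C = "M * C * Bg"])
    show "((\<lambda>s. F (poly (P s) y) * poly g y) has_real_derivative
        F' (poly (P t) y) * P' y * poly g y) (at t within J)" for y
      by (intro DERIV_cmult_right DERIV_chain2[OF F P'])
    show "(\<lambda>y. F (poly (P s) y) * poly g y) integrable_on {l..r}" for s
      by (intro integrable_continuous_real continuous_intros continuous_on_compose2[OF F_cont]) auto
    have "\<forall>\<^sub>F s in at t within J. \<bar>s - t\<bar> < 1"
      by (auto simp: eventually_at dist_real_def intro!: exI[of _ 1])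
    then show "\<forall>\<^sub>F s in at t within J. \<forall>y\<in>{l..r}.
        \<bar>F (poly (P s) y) * poly g y - F (poly (P t) y) * poly g y\<bar> \<le> M * C * Bg * \<bar>s - t\<bar>"
      using lip
    proof eventually_elim
      case (elim s)
      show ?case
      proof
        fix y assume y: "y \<in> {l..r}"
        have close: "\<bar>poly (P s) y - poly (P t) y\<bar> \<le> C * \<bar>s - t\<bar>" using elim(2) y by blast
        also have "\<dots> \<le> \<bar>C\<bar> * \<bar>s - t\<bar>" by (intro mult_right_mono) auto
        also have "\<dots> \<le> \<bar>C\<bar> * 1" using elim(1) by (intro mult_left_mono) auto
        finally have in_range: "poly (P s) y \<in> {-(B + \<bar>C\<bar>)..B + \<bar>C\<bar>}"
          "poly (P t) y \<in> {-(B + \<bar>C\<bar>)..B + \<bar>C\<bar>}"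
          using B[OF y] by auto
        have M0: "0 \<le> M" using M[OF in_range(1)] by linarith
        have "\<bar>F (poly (P s) y) * poly g y - F (poly (P t) y) * poly g y\<bar> =
            \<bar>F (poly (P s) y) - F (poly (P t) y)\<bar> * \<bar>poly g y\<bar>"
          by (simp add: abs_mult flip: left_diff_distrib)
        also have "\<dots> \<le> (M * (C * \<bar>s - t\<bar>)) * Bg"
        proof (rule mult_mono)
          show "\<bar>F (poly (P s) y) - F (poly (P t) y)\<bar> \<le> M * (C * \<bar>s - t\<bar>)"
            using F_lip[OF in_range] mult_left_mono[OF close M0] by linarith
          then show "0 \<le> M * (C * \<bar>s - t\<bar>)" by linarith
        qed (use Bg[OF y] in auto)
        finally show "\<bar>F (poly (P s) y) * poly g y - F (poly (P t) y) * poly g y\<bar>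
            \<le> M * C * Bg * \<bar>s - t\<bar>"
          by (simp add: mult_ac)
      qed
    qed
  qed (rule integrable_const_ivl)
qed

section \<open>Piecewise polynomials on a periodic mesh\<close>

lemma integral_pderiv:
  fixes R :: "real poly"
  assumes "l \<le> r"
  shows "integral {l..r} (poly (pderiv R)) = poly R r - poly R l"
proof (intro integral_unique fundamental_theorem_of_calculus assms)
  show "(poly R has_vector_derivative poly (pderiv R) y) (at y within {l..r})" for y
    unfolding has_real_derivative_iff_has_vector_derivative[symmetric]
    using poly_DERIV by (rule has_field_derivative_at_within)
qed

locale periodic_mesh =
  fixes N :: nat and x :: "nat \<Rightarrow> real"
  assumes node_less_Suc: "\<And>i. i < N \<Longrightarrow> x i < x (Suc i)"
begin

text \<open>Degree bounds are kept separate: traces and integrals need only the polynomials,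
  membership in \<open>Wh\<close> needs both.\<close>

definition pieces :: "(nat \<Rightarrow> real poly) \<Rightarrow> (real \<Rightarrow> real) \<Rightarrow> bool" where
  "pieces P w \<longleftrightarrow> (\<forall>i\<in>{1..N}. \<forall>y\<in>elem x i. w y = poly (P i) y)"

lemma piecesD: "pieces P w \<Longrightarrow> i \<in> {1..N} \<Longrightarrow> y \<in> elem x i \<Longrightarrow> w y = poly (P i) y"
  by (simp add: pieces_def)

lemma node_less: "i \<in> {1..N} \<Longrightarrow> x (i - 1) < x i"
  using node_less_Suc[of "i - 1"] by (cases i) auto

lemma node_mono: "i \<le> j \<Longrightarrow> j \<le> N \<Longrightarrow> x i \<le> x j"
proof (induction j rule: dec_induct)
  case (step j)
  then show ?case using node_less_Suc[of j] by simp
qed simp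

text \<open>Disjointness of the elements is what allows local polynomials to be glued into one
  function in \<open>L2_proj_exists\<close>.\<close>

lemma elem_unique:
  assumes "y \<in> elem x i" "y \<in> elem x j" "i \<in> {1..N}" "j \<in> {1..N}"
  shows "i = j"
proof (rule linorder_cases[of i j])
  assume "i < j"
  then show ?thesis using node_mono[of i "j - 1"] assms by (cases j) (auto simp: elem_def)
next
  assume "j < i"
  then show ?thesis using node_mono[of j "i - 1"] assms by (cases i) (auto simp: elem_def)
qed

lemma Wh_pieces:
  assumes "w \<in> Wh x N k"
  obtains P where "pieces P w" "\<forall>i\<in>{1..N}. degree (P i) \<le> k"
proof -
  from bchoice[OF assms[unfolded Wh_def mem_Collect_eq]] obtain P
    where "\<forall>i\<in>{1..N}. degree (P i) \<le> k \<and> (\<forall>y\<in>elem x i. w y = poly (P i) y)" ..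
  then show thesis by (intro that[of P]) (simp_all add: pieces_def)
qed

lemma pieces_Wh: "pieces P w \<Longrightarrow> (\<And>i. i \<in> {1..N} \<Longrightarrow> degree (P i) \<le> k) \<Longrightarrow> w \<in> Wh x N k"
  unfolding Wh_def pieces_def mem_Collect_eq
proof
  fix i assume "\<forall>i\<in>{1..N}. \<forall>y\<in>elem x i. w y = poly (P i) y"
    "\<And>i. i \<in> {1..N} \<Longrightarrow> degree (P i) \<le> k" "i \<in> {1..N}"
  then show "\<exists>P. degree P \<le> k \<and> (\<forall>y\<in>elem x i. w y = poly P y)"
    by (intro exI[of _ "P i"]) simp
qed

text \<open>Elements are open, so \<open>w\<close> coincides with its polynomial near each of their
  points, whatever its values at the nodes.\<close>

lemma pieces_deriv: "pieces P w \<Longrightarrow> pieces (\<lambda>i. pderiv (P i)) (deriv w)"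
  unfolding pieces_def
proof (intro ballI DERIV_imp_deriv)
  fix i y assume *: "\<forall>i\<in>{1..N}. \<forall>y\<in>elem x i. w y = poly (P i) y" "i \<in> {1..N}" "y \<in> elem x i"
  show "(w has_real_derivative poly (pderiv (P i)) y) (at y)"
    by (rule has_field_derivative_transform_within_open[OF poly_DERIV, of "elem x i"])
       (use * in \<open>auto simp: elem_def\<close>)
qed

lemma deriv_Wh: "w \<in> Wh x N k \<Longrightarrow> deriv w \<in> Wh x N k"
  by (elim Wh_pieces, rule pieces_Wh[OF pieces_deriv], assumption)
     (auto simp: degree_pderiv le_diff_conv le_SucI)

text \<open>Endpoints do not affect the integral, so it can be computed on the closed element from a
  representative \<open>\<Phi> i\<close>, for which continuity and the fundamental theorem are
  available up to the nodes.\<close>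

lemma mesh_integral_eq:
  assumes "\<And>i y. i \<in> {1..N} \<Longrightarrow> y \<in> elem x i \<Longrightarrow> \<phi> y = \<Phi> i y"
  shows "mesh_integral x N \<phi> = (\<Sum>i=1..N. integral {x (i - 1)..x i} (\<Phi> i))"
  unfolding mesh_integral_def
proof (rule sum.cong[OF refl])
  fix i assume "i \<in> {1..N}"
  then have "integral (elem x i) \<phi> = integral (elem x i) (\<Phi> i)"
    using assms by (intro Henstock_Kurzweil_Integration.integral_cong)
  then show "integral (elem x i) \<phi> = integral {x (i - 1)..x i} (\<Phi> i)"
    by (simp add: elem_def integral_open_interval_real)
qed

lemma mesh_inner_pieces:
  assumes "pieces P v" "pieces Q w"
  shows "mesh_inner x N v w =
    (\<Sum>i=1..N. integral {x (i - 1)..x i} (\<lambda>y. poly (P i) y * poly (Q i) y))"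
  unfolding mesh_inner_def using assms by (intro mesh_integral_eq) (simp add: piecesD)

lemma mesh_inner_commute: "mesh_inner x N v w = mesh_inner x N w v"
  by (simp add: mesh_inner_def mult.commute)

section \<open>One-sided traces and periodic boundary sums\<close>

lemma trace_minus_eq:
  assumes "i \<in> {1..N}" "\<And>y. y \<in> elem x i \<Longrightarrow> \<phi> y = \<Phi> y" "isCont \<Phi> (x i)"
  shows "trace_minus x N \<phi> i = \<Phi> (x i)"
proof -
  have "\<forall>\<^sub>F y in at_left (x i). \<phi> y = \<Phi> y"
    using node_less[OF assms(1)] assms(2) unfolding eventually_at_left_field elem_def by force
  then have "(\<phi> \<longlongrightarrow> \<Phi> (x i)) (at_left (x i))"
    using assms(3) by (auto simp: tendsto_cong isCont_def intro: filterlim_mono at_le)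
  then show ?thesis using assms(1) by (simp add: trace_minus_def tendsto_Lim)
qed

lemma trace_plus_eq:
  assumes "i \<in> {1..N}" "\<And>y. y \<in> elem x i \<Longrightarrow> \<phi> y = \<Phi> y" "isCont \<Phi> (x (i - 1))"
  shows "trace_plus x N \<phi> (i - 1) = \<Phi> (x (i - 1))"
proof -
  have "\<forall>\<^sub>F y in at_right (x (i - 1)). \<phi> y = \<Phi> y"
    using node_less[OF assms(1)] assms(2) unfolding eventually_at_right_field elem_def by force
  then have "(\<phi> \<longlongrightarrow> \<Phi> (x (i - 1))) (at_right (x (i - 1)))"
    using assms(3) by (auto simp: tendsto_cong isCont_def intro: filterlim_mono at_le)
  \<comment> \<open>The wrap-around case in \<open>trace_plus\<close> is excluded, since the left
    end of an element is never the last node.\<close>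
  moreover have "i - 1 \<noteq> N" using assms(1) by auto
  ultimately show ?thesis by (simp add: trace_plus_def tendsto_Lim)
qed

lemma trace_plus_periodic: "trace_plus x N \<phi> 0 = trace_plus x N \<phi> N"
  by (simp add: trace_plus_def)

lemma trace_minus_periodic: "trace_minus x N \<phi> 0 = trace_minus x N \<phi> N"
  by (simp add: trace_minus_def)

lemma jump_periodic: "jump x N \<phi> 0 = jump x N \<phi> N"
  by (simp add: jump_def trace_plus_periodic trace_minus_periodic)

lemma avg_periodic: "avg x N \<phi> 0 = avg x N \<phi> N"
  by (simp add: avg_def trace_plus_periodic trace_minus_periodic)

text \<open>Right traces occur at the left end of each element. Periodicity lets them be summed over
  the same nodes as the left traces, which is how jumps arise.\<close>

lemma sum_shift_periodic:
  fixes h :: "nat \<Rightarrow> real"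
  assumes "h 0 = h N"
  shows "(\<Sum>i=1..N. h (i - 1)) = (\<Sum>i=1..N. h i)"
proof -
  have "(\<Sum>i=1..N. h (i - 1)) = (\<Sum>i<N. h i)"
    by (rule sum.reindex_bij_witness[of _ Suc "\<lambda>i. i - 1"]) auto
  also have "\<dots> = (\<Sum>i<N. h (Suc i))"
    using sum.lessThan_Suc[of h N] sum.lessThan_Suc_shift[of h N] assms by simp
  also have "\<dots> = (\<Sum>i=1..N. h i)"
    by (rule sum.reindex_bij_witness[of _ "\<lambda>i. i - 1" Suc]) auto
  finally show ?thesis .
qed

text \<open>A single-valued periodic \<open>\<phi>\<close> factors out of the two contributions
  meeting at each node, leaving the jump of \<open>v\<close>.\<close>

lemma bdry_eq:
  assumes "\<phi> 0 = \<phi> N"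
  shows "bdry x N \<phi> v = (\<Sum>i=1..N. \<phi> i * jump x N v i)"
  using sum_shift_periodic[of "\<lambda>i. \<phi> i * trace_plus x N v i"] assms
  by (simp add: bdry_def jump_def trace_plus_periodic sum_subtractf right_diff_distrib)

section \<open>Integration by parts over the mesh\<close>

text \<open>The fundamental theorem gives endpoint differences on each element; regrouping them by
  nodes gives jumps. General \<open>\<Phi>\<close> are allowed because compositions such as
  \<open>F (w y)\<close> need not be polynomial.\<close>

lemma mesh_integral_deriv_eq_jumps:
  assumes deriv: "\<And>i y. i \<in> {1..N} \<Longrightarrow> (\<Phi> i has_real_derivative \<Phi>' i y) (at y)"
    and \<phi>: "\<And>i y. i \<in> {1..N} \<Longrightarrow> y \<in> elem x i \<Longrightarrow> \<phi> y = \<Phi> i y"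
    and \<phi>': "\<And>i y. i \<in> {1..N} \<Longrightarrow> y \<in> elem x i \<Longrightarrow> \<phi>' y = \<Phi>' i y"
  shows "mesh_integral x N \<phi>' = (\<Sum>i=1..N. jump x N \<phi> i)"
proof -
  have "mesh_integral x N \<phi>' = (\<Sum>i=1..N. integral {x (i - 1)..x i} (\<Phi>' i))"
    using \<phi>' by (rule mesh_integral_eq)
  also have "\<dots> = (\<Sum>i=1..N. trace_minus x N \<phi> i - trace_plus x N \<phi> (i - 1))"
  proof (rule sum.cong[OF refl])
    fix i assume i: "i \<in> {1..N}"
    have "(\<Phi>' i has_integral \<Phi> i (x i) - \<Phi> i (x (i - 1))) {x (i - 1)..x i}"
      using node_less[OF i] deriv[OF i]
      by (intro fundamental_theorem_of_calculus)
         (auto simp: has_real_derivative_iff_has_vector_derivative[symmetric]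
            intro: has_field_derivative_at_within)
    moreover have "isCont (\<Phi> i) y" for y using deriv[OF i] by (rule DERIV_isCont)
    ultimately show "integral {x (i - 1)..x i} (\<Phi>' i) =
        trace_minus x N \<phi> i - trace_plus x N \<phi> (i - 1)"
      using trace_minus_eq[OF i \<phi>[OF i]] trace_plus_eq[OF i \<phi>[OF i]]
      by (simp add: integral_unique)
  qed
  also have "\<dots> = (\<Sum>i=1..N. jump x N \<phi> i)"
    using sum_shift_periodic[of "trace_plus x N \<phi>"]
    by (simp add: jump_def sum_subtractf trace_plus_periodic)
  finally show ?thesis .
qed

text \<open>The integrand is the elementwise derivative of \<open>F (w y)\<close>. With
  \<open>F\<close> taken as \<open>V\<close>, this is the source of the jumps of \<open>V\<close> in
  the first condition on the penalization parameters.\<close>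

lemma mesh_inner_compose_deriv:
  assumes F: "\<And>z. (F has_real_derivative f z) (at z)" and w: "w \<in> Wh x N k"
  shows "mesh_inner x N (\<lambda>y. f (w y)) (deriv w) = (\<Sum>i=1..N. jump x N (\<lambda>y. F (w y)) i)"
proof -
  obtain P where P: "pieces P w" using w by (rule Wh_pieces)
  show ?thesis
    unfolding mesh_inner_def
    by (rule mesh_integral_deriv_eq_jumps[where \<Phi> = "\<lambda>i y. F (poly (P i) y)"
          and \<Phi>' = "\<lambda>i y. f (poly (P i) y) * poly (pderiv (P i)) y"])
       (auto intro: DERIV_chain2[OF F poly_DERIV] simp: piecesD[OF P] piecesD[OF pieces_deriv[OF P]])
qed

lemma trace_minus_pieces: "pieces P w \<Longrightarrow> i \<in> {1..N} \<Longrightarrow> trace_minus x N w i = poly (P i) (x i)"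
  by (rule trace_minus_eq) (auto simp: piecesD poly_isCont)

lemma trace_plus_pieces:
  "pieces P w \<Longrightarrow> i \<in> {1..N} \<Longrightarrow> trace_plus x N w (i - 1) = poly (P i) (x (i - 1))"
  by (rule trace_plus_eq) (auto simp: piecesD poly_isCont)

lemma mesh_integration_by_parts:
  assumes v: "v \<in> Wh x N k" and w: "w \<in> Wh x N k"
  shows "mesh_inner x N v (deriv w) + mesh_inner x N (deriv v) w =
    (\<Sum>i=1..N. avg x N v i * jump x N w i + jump x N v i * avg x N w i)"
proof -
  obtain P where P: "pieces P v" using v by (rule Wh_pieces)
  obtain Q where Q: "pieces Q w" using w by (rule Wh_pieces)
  let ?p = "\<lambda>i. trace_plus x N v i * trace_plus x N w i"
  have product_rule: "poly (pderiv (P i * Q i)) =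
      (\<lambda>y. poly (P i) y * poly (pderiv (Q i)) y + poly (pderiv (P i)) y * poly (Q i) y)" for i
    by (simp add: fun_eq_iff pderiv_mult mult.commute)
  have "mesh_inner x N v (deriv w) + mesh_inner x N (deriv v) w =
      (\<Sum>i=1..N. integral {x (i - 1)..x i} (poly (pderiv (P i * Q i))))"
    unfolding mesh_inner_pieces[OF P pieces_deriv[OF Q]] mesh_inner_pieces[OF pieces_deriv[OF P] Q]
    by (simp add: product_rule integral_add integrable_continuous_real continuous_intros
        flip: sum.distrib)
  also have "\<dots> = (\<Sum>i=1..N. trace_minus x N v i * trace_minus x N w i - ?p (i - 1))"
  proof (rule sum.cong[OF refl])
    fix i assume i: "i \<in> {1..N}"
    show "integral {x (i - 1)..x i} (poly (pderiv (P i * Q i))) =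
        trace_minus x N v i * trace_minus x N w i - ?p (i - 1)"
      using node_less[OF i] i by (simp only: integral_pderiv less_imp_le trace_minus_pieces[OF P] trace_minus_pieces[OF Q]
          trace_plus_pieces[OF P] trace_plus_pieces[OF Q] poly_mult)
  qed
  also have "\<dots> = (\<Sum>i=1..N. trace_minus x N v i * trace_minus x N w i - ?p i)"
    unfolding sum_subtractf by (subst sum_shift_periodic[of ?p]) (simp_all add: trace_plus_periodic)
  \<comment> \<open>The discrete product rule: the jump of a product is average times jump plus jump
    times average.\<close>
  also have "\<dots> = (\<Sum>i=1..N. avg x N v i * jump x N w i + jump x N v i * avg x N w i)"
    by (intro sum.cong) (auto simp: avg_def jump_def field_simps)
  finally show ?thesis .
qed

lemma mesh_inner_deriv_self:
  assumes w: "w \<in> Wh x N k"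
  shows "mesh_inner x N w (deriv w) = (\<Sum>i=1..N. avg x N w i * jump x N w i)"
proof -
  have "2 * mesh_inner x N w (deriv w) =
      (\<Sum>i=1..N. avg x N w i * jump x N w i + jump x N w i * avg x N w i)"
    using mesh_integration_by_parts[OF w w] mesh_inner_commute[of "deriv w" w] by linarith
  also have "\<dots> = 2 * (\<Sum>i=1..N. avg x N w i * jump x N w i)"
    unfolding sum_distrib_left by (rule sum.cong) auto
  finally show ?thesis by simp
qed

section \<open>Existence of the L2 projection\<close>

text \<open>\<open>L2_proj\<close> is given by choice, so its defining property has to be earned by
  existence. Membership in \<open>Wh\<close> imposes no coupling between elements, so the local
  projections can simply be glued.\<close>

lemma L2_proj_exists:
  assumes cont: "\<And>i. i \<in> {1..N} \<Longrightarrow> continuous_on {x (i - 1)..x i} (\<Phi> i)"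
    and \<phi>: "\<And>i y. i \<in> {1..N} \<Longrightarrow> y \<in> elem x i \<Longrightarrow> \<phi> y = \<Phi> i y"
  shows "L2_proj x N k \<phi> \<in> Wh x N k \<and>
    (\<forall>v\<in>Wh x N k. mesh_inner x N (L2_proj x N k \<phi>) v = mesh_inner x N \<phi> v)"
proof -
  have "\<exists>P. \<forall>i\<in>{1..N}. degree (P i) \<le> k \<and> (\<forall>v. degree v \<le> k \<longrightarrow>
      integral {x (i - 1)..x i} (\<lambda>y. poly (P i) y * poly v y) =
      integral {x (i - 1)..x i} (\<lambda>y. \<Phi> i y * poly v y))"
    using node_less cont by (intro bchoice ballI poly_L2_projection)
  then obtain P where P: "\<And>i. i \<in> {1..N} \<Longrightarrow> degree (P i) \<le> k"
    "\<And>i v. i \<in> {1..N} \<Longrightarrow> degree v \<le> k \<Longrightarrow>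
      integral {x (i - 1)..x i} (\<lambda>y. poly (P i) y * poly v y) =
      integral {x (i - 1)..x i} (\<lambda>y. \<Phi> i y * poly v y)" by blast
  define \<omega> where "\<omega> y = poly (P (THE i. i \<in> {1..N} \<and> y \<in> elem x i)) y" for y
  have \<omega>: "pieces P \<omega>"
    unfolding pieces_def
  proof (intro ballI)
    fix i y assume *: "i \<in> {1..N}" "y \<in> elem x i"
    then have "(THE i. i \<in> {1..N} \<and> y \<in> elem x i) = i"
      using elem_unique by (intro the_equality) blast+
    then show "\<omega> y = poly (P i) y" by (simp add: \<omega>_def)
  qed
  have "mesh_inner x N \<omega> v = mesh_inner x N \<phi> v" if v: "v \<in> Wh x N k" for v
  proof -
    obtain Q where Q: "pieces Q v" "\<forall>i\<in>{1..N}. degree (Q i) \<le> k"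
      using v by (rule Wh_pieces)
    have "mesh_inner x N \<phi> v =
        (\<Sum>i=1..N. integral {x (i - 1)..x i} (\<lambda>y. \<Phi> i y * poly (Q i) y))"
      unfolding mesh_inner_def by (rule mesh_integral_eq) (simp add: \<phi> piecesD[OF Q(1)])
    then show ?thesis
      unfolding mesh_inner_pieces[OF \<omega> Q(1)] using P(2) Q(2) by simp
  qed
  then have "\<exists>\<omega>. \<omega> \<in> Wh x N k \<and> (\<forall>v\<in>Wh x N k. mesh_inner x N \<omega> v = mesh_inner x N \<phi> v)"
    using pieces_Wh[OF \<omega> P(1)] by blast
  then show ?thesis unfolding L2_proj_def by (rule someI_ex)
qed

text \<open>On each element \<open>f (w y)\<close> extends continuously to the closed element
  through the polynomial of \<open>w\<close>, even where \<open>w\<close> itself jumps.\<close>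

lemma L2_proj_compose:
  assumes f: "continuous_on UNIV f" and w: "w \<in> Wh x N k"
  shows "L2_proj x N k (\<lambda>y. f (w y)) \<in> Wh x N k"
    and "v \<in> Wh x N k \<Longrightarrow>
      mesh_inner x N (L2_proj x N k (\<lambda>y. f (w y))) v = mesh_inner x N (\<lambda>y. f (w y)) v"
proof -
  obtain P where P: "pieces P w" using w by (rule Wh_pieces)
  have "L2_proj x N k (\<lambda>y. f (w y)) \<in> Wh x N k \<and> (\<forall>v\<in>Wh x N k.
      mesh_inner x N (L2_proj x N k (\<lambda>y. f (w y))) v = mesh_inner x N (\<lambda>y. f (w y)) v)"
    by (rule L2_proj_exists[of "\<lambda>i y. f (poly (P i) y)"])
       (auto simp: piecesD[OF P] intro!: continuous_on_compose2[OF f] continuous_intros)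
  then show "L2_proj x N k (\<lambda>y. f (w y)) \<in> Wh x N k"
    and "v \<in> Wh x N k \<Longrightarrow>
      mesh_inner x N (L2_proj x N k (\<lambda>y. f (w y))) v = mesh_inner x N (\<lambda>y. f (w y)) v"
    by blast+
qed

end

lemma jump_const: "jump x N (\<lambda>_. c) i = 0"
proof -
  have "Lim (at_left y) (\<lambda>_. c) = c" "Lim (at_right y) (\<lambda>_. c) = c" for y :: real
    by (auto intro: tendsto_Lim)
  then show ?thesis by (simp add: jump_def trace_minus_def trace_plus_def)
qed

lemma mesh_integral_cmult: "mesh_integral x N (\<lambda>y. c * \<phi> y) = c * mesh_integral x N \<phi>"
  by (simp add: mesh_integral_def sum_distrib_left)

context periodic_mesh
begin

lemma const_Wh: "(\<lambda>_. c) \<in> Wh x N k"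
  by (auto simp: Wh_def intro!: exI[of _ "[:c:]"])

text \<open>Splitting an integral requires integrability of both parts; it comes from continuity of
  the compositions with the local polynomials.\<close>

lemma mesh_integral_diff_compose:
  assumes F: "continuous_on UNIV F" and G: "continuous_on UNIV G"
    and v: "v \<in> Wh x N k" and w: "w \<in> Wh x N m"
  shows "mesh_integral x N (\<lambda>y. F (v y) - G (w y)) =
    mesh_integral x N (\<lambda>y. F (v y)) - mesh_integral x N (\<lambda>y. G (w y))"
proof -
  obtain P where P: "pieces P v" using v by (rule Wh_pieces)
  obtain Q where Q: "pieces Q w" using w by (rule Wh_pieces)
  have int: "(\<lambda>y. H (poly R y)) integrable_on {l..r}"
    if "continuous_on UNIV H" for H :: "real \<Rightarrow> real" and R l r
    by (intro integrable_continuous_real continuous_on_compose2[OF that] continuous_intros) auto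
  have "mesh_integral x N (\<lambda>y. F (v y) - G (w y)) =
      (\<Sum>i=1..N. integral {x (i - 1)..x i} (\<lambda>y. F (poly (P i) y) - G (poly (Q i) y)))"
    by (rule mesh_integral_eq) (simp add: piecesD[OF P] piecesD[OF Q])
  also have "\<dots> = (\<Sum>i=1..N. integral {x (i - 1)..x i} (\<lambda>y. F (poly (P i) y)))
      - (\<Sum>i=1..N. integral {x (i - 1)..x i} (\<lambda>y. G (poly (Q i) y)))"
    by (simp add: integral_diff int[OF F] int[OF G] sum_subtractf)
  also have "(\<Sum>i=1..N. integral {x (i - 1)..x i} (\<lambda>y. F (poly (P i) y))) =
      mesh_integral x N (\<lambda>y. F (v y))"
    by (rule mesh_integral_eq[symmetric]) (simp add: piecesD[OF P])
  also have "(\<Sum>i=1..N. integral {x (i - 1)..x i} (\<lambda>y. G (poly (Q i) y))) =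
      mesh_integral x N (\<lambda>y. G (w y))"
    by (rule mesh_integral_eq[symmetric]) (simp add: piecesD[OF Q])
  finally show ?thesis .
qed

end

section \<open>Time-dependent piecewise polynomials\<close>

lemma has_real_derivative_unique_within:
  fixes \<phi> :: "real \<Rightarrow> real"
  assumes "at t within J \<noteq> bot" "(\<phi> has_real_derivative d) (at t within J)"
    "(\<phi> has_real_derivative e) (at t within J)"
  shows "d = e"
  using assms vector_derivative_unique_within
  unfolding has_real_derivative_iff_has_vector_derivative by blast

lemma tderiv_eq:
  assumes "at t within J \<noteq> bot" "(\<phi> has_real_derivative d) (at t within J)"
  shows "tderiv J \<phi> t = d"
  using assms vector_derivative_within
  unfolding tderiv_def has_real_derivative_iff_has_vector_derivative by blast

text \<open>A nondegenerate interval has no isolated points. Hence derivatives within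
  \<open>J\<close> are unique, at endpoints too, and \<open>tderiv\<close> returns the actual
  derivative.\<close>

lemma at_within_interval_neq_bot:
  fixes J :: "real set"
  assumes "is_interval J" "interior J \<noteq> {}" "t \<in> J"
  shows "at t within J \<noteq> bot"
proof -
  have "J \<noteq> {t}" using assms(2) by auto
  then have "t islimpt J"
    using assms by (intro connected_imp_perfect) (auto simp: is_interval_connected)
  then show ?thesis by (simp add: trivial_limit_within)
qed

locale moving_Wh = periodic_mesh +
  fixes k :: nat and J :: "real set" and t :: real and w :: "real \<Rightarrow> real \<Rightarrow> real"
  assumes t: "t \<in> J" and at_t: "at t within J \<noteq> bot"
    and Wh: "\<And>s. s \<in> J \<Longrightarrow> w s \<in> Wh x N k"
    and diff: "\<And>i y. i \<in> {1..N} \<Longrightarrow> y \<in> elem x i \<Longrightarrow> (\<lambda>s. w s y) differentiable (at t within J)"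
begin

definition wt :: "real \<Rightarrow> real" where "wt y = tderiv J (\<lambda>s. w s y) t"

text \<open>Besides the local polynomials, this supplies that the time derivative is again piecewise
  polynomial of degree at most \<open>k\<close>, hence an admissible test function.\<close>

lemma time_pieces:
  obtains P P' C where "\<And>s. s \<in> J \<Longrightarrow> pieces (P s) (w s)"
    and "pieces P' wt" and "\<And>i. i \<in> {1..N} \<Longrightarrow> degree (P' i) \<le> k"
    and "\<And>i y. i \<in> {1..N} \<Longrightarrow>
      ((\<lambda>s. poly (P s i) y) has_real_derivative poly (P' i) y) (at t within J)"
    and "\<And>i. i \<in> {1..N} \<Longrightarrow> \<forall>\<^sub>F s in at t within J. \<forall>y\<in>{x (i - 1)..x i}.
      \<bar>poly (P s i) y - poly (P t i) y\<bar> \<le> C i * \<bar>s - t\<bar>"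
proof -
  \<comment> \<open>The polynomials are chosen separately at each time. They still depend
    differentiably on time at \<open>t\<close>, because on the open elements their values are those
    of \<open>w\<close>.\<close>
  have "\<forall>s\<in>J. \<exists>P. pieces P (w s) \<and> (\<forall>i\<in>{1..N}. degree (P i) \<le> k)"
    by (intro ballI, drule Wh, erule Wh_pieces) blast
  from bchoice[OF this] obtain P
    where "\<forall>s\<in>J. pieces (P s) (w s) \<and> (\<forall>i\<in>{1..N}. degree (P s i) \<le> k)" ..
  then have P: "\<And>s. s \<in> J \<Longrightarrow> pieces (P s) (w s)"
    "\<And>s i. s \<in> J \<Longrightarrow> i \<in> {1..N} \<Longrightarrow> degree (P s i) \<le> k"
    by simp_all
  have P_w: "poly (P s i) y = w s y" if "s \<in> J" "i \<in> {1..N}" "y \<in> elem x i" for s i y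
    using piecesD[OF P(1)] that by simp
  have "\<exists>P' C. degree P' \<le> k
      \<and> (\<forall>y. ((\<lambda>s. poly (P s i) y) has_real_derivative poly P' y) (at t within J))
      \<and> (\<forall>\<^sub>F s in at t within J. \<forall>y\<in>{x (i - 1)..x i}.
        \<bar>poly (P s i) y - poly (P t i) y\<bar> \<le> C * \<bar>s - t\<bar>)"
    if i: "i \<in> {1..N}" for i
  proof -
    have "(\<lambda>s. poly (P s i) y) differentiable (at t within J)" if "y \<in> {x (i - 1)<..<x i}" for y
      by (rule differentiable_transform_within[OF _ zero_less_one t, of "\<lambda>s. w s y"])
         (use diff[OF i] that P_w[OF _ i] in \<open>auto simp: elem_def\<close>)
    then obtain P' C where "degree P' \<le> k"
      "\<And>y. ((\<lambda>s. poly (P s i) y) has_real_derivative poly P' y) (at t within J)"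
      "\<forall>\<^sub>F s in at t within J. \<forall>y\<in>{x (i - 1)..x i}.
        \<bar>poly (P s i) y - poly (P t i) y\<bar> \<le> C * \<bar>s - t\<bar>"
      using poly_family_has_derivative[OF t node_less[OF i], of "\<lambda>s. P s i" k] P(2)[OF _ i]
      by blast
    then show ?thesis by (intro exI[of _ P'] exI[of _ C]) simp
  qed
  \<comment> \<open>Derivative and Lipschitz constant are paired so that one application of choice
    selects both.\<close>
  then have "\<forall>i\<in>{1..N}. \<exists>P'C. degree (fst P'C) \<le> k
      \<and> (\<forall>y. ((\<lambda>s. poly (P s i) y) has_real_derivative poly (fst P'C) y) (at t within J))
      \<and> (\<forall>\<^sub>F s in at t within J. \<forall>y\<in>{x (i - 1)..x i}.
        \<bar>poly (P s i) y - poly (P t i) y\<bar> \<le> snd P'C * \<bar>s - t\<bar>)"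
    by simp
  from bchoice[OF this] obtain R where "\<forall>i\<in>{1..N}. degree (fst (R i)) \<le> k
      \<and> (\<forall>y. ((\<lambda>s. poly (P s i) y) has_real_derivative poly (fst (R i)) y) (at t within J))
      \<and> (\<forall>\<^sub>F s in at t within J. \<forall>y\<in>{x (i - 1)..x i}.
        \<bar>poly (P s i) y - poly (P t i) y\<bar> \<le> snd (R i) * \<bar>s - t\<bar>)" ..
  then have R: "\<And>i. i \<in> {1..N} \<Longrightarrow> degree (fst (R i)) \<le> k"
    "\<And>i y. i \<in> {1..N} \<Longrightarrow>
      ((\<lambda>s. poly (P s i) y) has_real_derivative poly (fst (R i)) y) (at t within J)"
    "\<And>i. i \<in> {1..N} \<Longrightarrow> \<forall>\<^sub>F s in at t within J. \<forall>y\<in>{x (i - 1)..x i}.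
        \<bar>poly (P s i) y - poly (P t i) y\<bar> \<le> snd (R i) * \<bar>s - t\<bar>"
    by simp_all
  have wt: "pieces (\<lambda>i. fst (R i)) wt"
    unfolding pieces_def wt_def
  proof (intro ballI tderiv_eq at_t)
    fix i y assume *: "i \<in> {1..N}" "y \<in> elem x i"
    show "((\<lambda>s. w s y) has_real_derivative poly (fst (R i)) y) (at t within J)"
      by (rule has_field_derivative_transform_within[OF R(2)[OF *(1)] zero_less_one t])
         (rule P_w[OF _ *])
  qed
  show thesis by (rule that[OF P(1) wt R])
qed

lemma wt_Wh: "wt \<in> Wh x N k"
  by (rule time_pieces) (rule pieces_Wh)

lemma has_derivative_mesh_integral:
  assumes F: "\<And>z. (F has_real_derivative F' z) (at z)" and F': "continuous_on UNIV F'"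
    and g: "g \<in> Wh x N m"
  shows "((\<lambda>s. mesh_integral x N (\<lambda>y. F (w s y) * g y)) has_real_derivative
    mesh_integral x N (\<lambda>y. F' (w t y) * wt y * g y)) (at t within J)"
proof -
  obtain P P' C where P: "\<And>s. s \<in> J \<Longrightarrow> pieces (P s) (w s)" "pieces P' wt"
    "\<And>i y. i \<in> {1..N} \<Longrightarrow> ((\<lambda>s. poly (P s i) y) has_real_derivative poly (P' i) y) (at t within J)"
    "\<And>i. i \<in> {1..N} \<Longrightarrow> \<forall>\<^sub>F s in at t within J. \<forall>y\<in>{x (i - 1)..x i}.
      \<bar>poly (P s i) y - poly (P t i) y\<bar> \<le> C i * \<bar>s - t\<bar>"
    by (rule time_pieces) (rule that)
  obtain G where G: "pieces G g" using g by (rule Wh_pieces)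
  have eq: "mesh_integral x N (\<lambda>y. F (w s y) * g y) =
      (\<Sum>i=1..N. integral {x (i - 1)..x i} (\<lambda>y. F (poly (P s i) y) * poly (G i) y))"
    if "s \<in> J" for s
    using P(1)[OF that] G by (intro mesh_integral_eq) (simp add: piecesD)
  have eq': "mesh_integral x N (\<lambda>y. F' (w t y) * wt y * g y) =
      (\<Sum>i=1..N. integral {x (i - 1)..x i} (\<lambda>y. F' (poly (P t i) y) * poly (P' i) y * poly (G i) y))"
    using P(1)[OF t] P(2) G by (intro mesh_integral_eq) (simp add: piecesD)
  have "((\<lambda>s. \<Sum>i=1..N. integral {x (i - 1)..x i} (\<lambda>y. F (poly (P s i) y) * poly (G i) y))
      has_real_derivative mesh_integral x N (\<lambda>y. F' (w t y) * wt y * g y)) (at t within J)"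
    unfolding eq' by (intro DERIV_sum has_real_derivative_integral_poly_family[OF P(3,4) F F'])
  then show ?thesis
    by (rule has_field_derivative_transform_within[OF _ zero_less_one t]) (simp add: eq)
qed

lemma has_derivative_mesh_inner:
  assumes "g \<in> Wh x N m"
  shows "((\<lambda>s. mesh_inner x N (w s) g) has_real_derivative mesh_inner x N wt g) (at t within J)"
  using has_derivative_mesh_integral[of "\<lambda>z. z" "\<lambda>_. 1", OF DERIV_ident _ assms]
  by (simp add: mesh_inner_def)

lemma has_derivative_trace_minus:
  assumes "i \<in> {1..N}"
  shows "((\<lambda>s. trace_minus x N (w s) i) has_real_derivative trace_minus x N wt i) (at t within J)"
proof (rule time_pieces)
  fix P P' C assume P: "\<And>s. s \<in> J \<Longrightarrow> pieces (P s) (w s)" "pieces P' wt"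
    "\<And>i y. i \<in> {1..N} \<Longrightarrow> ((\<lambda>s. poly (P s i) y) has_real_derivative poly (P' i) y) (at t within J)"
  have "((\<lambda>s. poly (P s i) (x i)) has_real_derivative trace_minus x N wt i) (at t within J)"
    using P(3)[OF assms] by (simp add: trace_minus_pieces[OF P(2) assms])
  then show ?thesis
    by (rule has_field_derivative_transform_within[OF _ zero_less_one t])
       (simp add: trace_minus_pieces[OF P(1) assms])
qed

lemma has_derivative_trace_plus:
  assumes "i \<in> {1..N}"
  shows "((\<lambda>s. trace_plus x N (w s) i) has_real_derivative trace_plus x N wt i) (at t within J)"
proof -
  \<comment> \<open>The element to the right of node \<open>i\<close>; at the last node it wraps
    around to the first element.\<close>
  define j where "j = (if i = N then 1 else Suc i)"
  have j: "j \<in> {1..N}" and shift: "trace_plus x N \<phi> i = trace_plus x N \<phi> (j - 1)" for \<phi>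
    using assms by (auto simp: j_def trace_plus_periodic)
  show ?thesis
    unfolding shift
  proof (rule time_pieces)
    fix P P' C assume P: "\<And>s. s \<in> J \<Longrightarrow> pieces (P s) (w s)" "pieces P' wt"
      "\<And>i y. i \<in> {1..N} \<Longrightarrow> ((\<lambda>s. poly (P s i) y) has_real_derivative poly (P' i) y) (at t within J)"
    have "((\<lambda>s. poly (P s j) (x (j - 1))) has_real_derivative trace_plus x N wt (j - 1))
        (at t within J)"
      unfolding trace_plus_pieces[OF P(2) j] by (rule P(3)[OF j])
    then show "((\<lambda>s. trace_plus x N (w s) (j - 1)) has_real_derivative trace_plus x N wt (j - 1))
        (at t within J)"
      by (rule has_field_derivative_transform_within[OF _ zero_less_one t])
         (simp only: trace_plus_pieces[OF P(1) j])
  qed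
qed

lemma tderiv_jump: "i \<in> {1..N} \<Longrightarrow> tderiv J (\<lambda>s. jump x N (w s) i) t = jump x N wt i"
  unfolding jump_def
  by (intro tderiv_eq at_t DERIV_diff has_derivative_trace_minus has_derivative_trace_plus)

lemma has_derivative_avg:
  "i \<in> {1..N} \<Longrightarrow> ((\<lambda>s. avg x N (w s) i) has_real_derivative avg x N wt i) (at t within J)"
  unfolding avg_def
  by (intro DERIV_cdivide DERIV_add has_derivative_trace_minus has_derivative_trace_plus)

end

section \<open>The conservation laws\<close>

theorem theorem2p1:
  fixes a b \<epsilon> :: real and N k :: nat and x :: "nat \<Rightarrow> real"
    and f V :: "real \<Rightarrow> real"
    and J :: "real set"
    and u q p :: "real \<Rightarrow> real \<Rightarrow> real"
    and \<tau>qu \<tau>pu :: "real \<Rightarrow> real"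
    and u_hat q_hat p_hat :: "real \<Rightarrow> nat \<Rightarrow> real"
  assumes mesh: "mesh a b N x"
    and f_cont: "continuous_on UNIV f"
    and V_antideriv: "\<And>y. (V has_real_derivative f y) (at y)"
    and J: "is_interval J" "interior J \<noteq> {}"
    and spaces: "\<And>t. t \<in> J \<Longrightarrow> u t \<in> Wh x N k \<and> q t \<in> Wh x N k \<and> p t \<in> Wh x N k"
    and u_diff: "\<And>t i y. t \<in> J \<Longrightarrow> i \<in> {1..N} \<Longrightarrow> y \<in> elem x i \<Longrightarrow>
                  (\<lambda>s. u s y) differentiable (at t within J)"
    and q_diff: "\<And>t i y. t \<in> J \<Longrightarrow> i \<in> {1..N} \<Longrightarrow> y \<in> elem x i \<Longrightarrow>
                  (\<lambda>s. q s y) differentiable (at t within J)"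
    and u_hat: "\<And>t i. t \<in> J \<Longrightarrow> i \<le> N \<Longrightarrow> u_hat t i = avg x N (u t) i"
    and q_hat: "\<And>t i. t \<in> J \<Longrightarrow> i \<le> N \<Longrightarrow>
                  q_hat t i = avg x N (q t) i + \<tau>qu t * jump x N (u t) i"
    and p_hat: "\<And>t i. t \<in> J \<Longrightarrow> i \<le> N \<Longrightarrow>
                  p_hat t i = avg x N (p t) i + \<tau>pu t * jump x N (u t) i"
    and eq_q: "\<And>t v. t \<in> J \<Longrightarrow> v \<in> Wh x N k \<Longrightarrow>
                  mesh_inner x N (q t) v + mesh_inner x N (u t) (deriv v)
                    - bdry x N (u_hat t) v = 0"
    and eq_p: "\<And>t z. t \<in> J \<Longrightarrow> z \<in> Wh x N k \<Longrightarrow>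
                  mesh_inner x N (p t) z + \<epsilon> * mesh_inner x N (q t) (deriv z)
                    - \<epsilon> * bdry x N (q_hat t) z = mesh_inner x N (\<lambda>y. f (u t y)) z"
    and eq_u: "\<And>t w. t \<in> J \<Longrightarrow> w \<in> Wh x N k \<Longrightarrow>
                  mesh_inner x N (\<lambda>y. tderiv J (\<lambda>s. u s y) t) w
                    - mesh_inner x N (p t) (deriv w) + bdry x N (p_hat t) w = 0"
    and tau1: "\<And>t. t \<in> J \<Longrightarrow>
                  \<tau>pu t * (\<Sum>i=1..N. (jump x N (u t) i)\<^sup>2)
                    - \<epsilon> * \<tau>qu t * (\<Sum>i=1..N. jump x N (u t) i * jump x N (q t) i)
                  = (\<Sum>i=1..N. jump x N (\<lambda>y. V (u t y)) i
                       - avg x N (L2_proj x N k (\<lambda>y. f (u t y))) i * jump x N (u t) i)"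
    and tau2: "\<And>t. t \<in> J \<Longrightarrow>
                  \<tau>pu t * (\<Sum>i=1..N. jump x N (p t) i * jump x N (u t) i)
                    + \<epsilon> * \<tau>qu t * (\<Sum>i=1..N. tderiv J (\<lambda>s. jump x N (u s) i) t * jump x N (u t) i)
                  = 0"
  shows "\<forall>t\<in>J.
      ((\<lambda>s. mesh_integral x N (u s)) has_real_derivative 0) (at t within J) \<and>
      ((\<lambda>s. mesh_integral x N (\<lambda>y. (u s y)\<^sup>2)) has_real_derivative 0) (at t within J) \<and>
      ((\<lambda>s. mesh_integral x N (\<lambda>y. \<epsilon> / 2 * (q s y)\<^sup>2 - V (u s y))) has_real_derivative 0)
        (at t within J)"
proof
  fix t assume t: "t \<in> J"
  interpret periodic_mesh N x
    using mesh by unfold_locales (auto simp: mesh_def)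
  have at_t: "at t within J \<noteq> bot"
    using J t by (rule at_within_interval_neq_bot)
  interpret U: moving_Wh N x k J t u
    using t at_t spaces u_diff by unfold_locales auto
  interpret Q: moving_Wh N x k J t q
    using t at_t spaces q_diff by unfold_locales auto
  let ?I = "mesh_inner x N"
  note u = spaces[OF t, THEN conjunct1] and q = spaces[OF t, THEN conjunct2, THEN conjunct1]
    and p = spaces[OF t, THEN conjunct2, THEN conjunct2]
  have V_cont: "continuous_on UNIV V"
    using V_antideriv by (meson DERIV_isCont continuous_at_imp_continuous_on)

  \<comment> \<open>The scheme rewritten with jumps and averages\<close>
  \<comment> \<open>Stated at all times in \<open>J\<close>, unlike the other equations, because it
    will be differentiated in time.\<close>
  have q_weak: "?I (q s) v + ?I (u s) (deriv v) - (\<Sum>i=1..N. avg x N (u s) i * jump x N v i) = 0"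
    if "s \<in> J" "v \<in> Wh x N k" for s v
  proof -
    have "bdry x N (u_hat s) v = (\<Sum>i=1..N. u_hat s i * jump x N v i)"
      using u_hat[OF that(1)] by (intro bdry_eq) (simp add: avg_periodic)
    also have "\<dots> = (\<Sum>i=1..N. avg x N (u s) i * jump x N v i)"
      using u_hat[OF that(1)] by (intro sum.cong) auto
    finally show ?thesis using eq_q[OF that] by simp
  qed
  have q_strong: "?I (q t) v = ?I (deriv (u t)) v - (\<Sum>i=1..N. jump x N (u t) i * avg x N v i)"
    if "v \<in> Wh x N k" for v
    using q_weak[OF t that] mesh_integration_by_parts[OF u that] by (simp add: sum.distrib)
  \<comment> \<open>For a fixed test function the residual \<open>?R\<close> vanishes on all of
    \<open>J\<close>, so its derivative at \<open>t\<close>, computed term by term, is zero.\<close>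
  have qt_weak: "?I Q.wt v + ?I U.wt (deriv v) = (\<Sum>i=1..N. avg x N U.wt i * jump x N v i)"
    if v: "v \<in> Wh x N k" for v
  proof -
    let ?R = "\<lambda>s. ?I (q s) v + ?I (u s) (deriv v) - (\<Sum>i=1..N. avg x N (u s) i * jump x N v i)"
    have "(?R has_real_derivative ?I Q.wt v + ?I U.wt (deriv v)
        - (\<Sum>i=1..N. avg x N U.wt i * jump x N v i)) (at t within J)"
      by (intro DERIV_diff DERIV_add DERIV_sum DERIV_cmult_right U.has_derivative_avg
          U.has_derivative_mesh_inner[OF deriv_Wh[OF v]] Q.has_derivative_mesh_inner[OF v])
    moreover have "(?R has_real_derivative 0) (at t within J)"
      by (rule has_field_derivative_transform_within[OF DERIV_const zero_less_one t])
         (simp only: q_weak[OF _ v])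
    ultimately show ?thesis
      using has_real_derivative_unique_within[OF at_t] by fastforce
  qed
  have p_weak: "?I (p t) z + \<epsilon> * ?I (q t) (deriv z)
      - \<epsilon> * (\<Sum>i=1..N. avg x N (q t) i * jump x N z i)
      - \<epsilon> * \<tau>qu t * (\<Sum>i=1..N. jump x N (u t) i * jump x N z i) = ?I (\<lambda>y. f (u t y)) z"
    if "z \<in> Wh x N k" for z
  proof -
    have "bdry x N (q_hat t) z = (\<Sum>i=1..N. q_hat t i * jump x N z i)"
      using q_hat[OF t] by (intro bdry_eq) (simp add: avg_periodic jump_periodic)
    also have "\<dots> = (\<Sum>i=1..N. avg x N (q t) i * jump x N z i
        + \<tau>qu t * (jump x N (u t) i * jump x N z i))"
      using q_hat[OF t] by (intro sum.cong) (auto simp: algebra_simps)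
    finally show ?thesis
      using eq_p[OF t that] by (simp add: sum.distrib algebra_simps flip: sum_distrib_left)
  qed
  have u_weak: "?I U.wt w - ?I (p t) (deriv w) + (\<Sum>i=1..N. avg x N (p t) i * jump x N w i)
      + \<tau>pu t * (\<Sum>i=1..N. jump x N (u t) i * jump x N w i) = 0"
    if "w \<in> Wh x N k" for w
  proof -
    have "bdry x N (p_hat t) w = (\<Sum>i=1..N. p_hat t i * jump x N w i)"
      using p_hat[OF t] by (intro bdry_eq) (simp add: avg_periodic jump_periodic)
    also have "\<dots> = (\<Sum>i=1..N. avg x N (p t) i * jump x N w i
        + \<tau>pu t * (jump x N (u t) i * jump x N w i))"
      using p_hat[OF t] by (intro sum.cong) (auto simp: algebra_simps)
    finally show ?thesis
      using eq_u[OF t that] by (simp add: sum.distrib U.wt_def[abs_def] flip: sum_distrib_left)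
  qed

  \<comment> \<open>Mass, energy and Hamiltonian\<close>
  have mass: "((\<lambda>s. mesh_integral x N (u s)) has_real_derivative 0) (at t within J)"
  proof -
    have "?I U.wt (\<lambda>_. 1) = 0"
      using u_weak[OF const_Wh[of 1]] by (simp add: jump_const mesh_inner_def mesh_integral_def)
    then show ?thesis
      using U.has_derivative_mesh_inner[OF const_Wh[of 1]] by (simp add: mesh_inner_def)
  qed

  have energy: "((\<lambda>s. mesh_integral x N (\<lambda>y. (u s y)\<^sup>2)) has_real_derivative 0) (at t within J)"
  proof -
    let ?\<Pi>f = "L2_proj x N k (\<lambda>y. f (u t y))"
    have \<Pi>f: "?\<Pi>f \<in> Wh x N k" using f_cont u by (rule L2_proj_compose)
    \<comment> \<open>As \<open>q t\<close> lies in \<open>Wh\<close>, \<open>f\<close> may be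
      replaced by its projection, which is then an admissible test function in
      \<open>q_strong\<close>. Against \<open>deriv (u t)\<close> the projection is undone. The
      result is the right-hand side of \<open>tau1\<close>.\<close>
    have f_q: "?I (\<lambda>y. f (u t y)) (q t) =
        (\<Sum>i=1..N. jump x N (\<lambda>y. V (u t y)) i - avg x N ?\<Pi>f i * jump x N (u t) i)"
    proof -
      have "?I (\<lambda>y. f (u t y)) (q t) = ?I (q t) ?\<Pi>f"
        using L2_proj_compose(2)[OF f_cont u q] by (simp only: mesh_inner_commute)
      also have "\<dots> = ?I ?\<Pi>f (deriv (u t)) - (\<Sum>i=1..N. jump x N (u t) i * avg x N ?\<Pi>f i)"
        using q_strong[OF \<Pi>f] by (simp only: mesh_inner_commute)
      also have "?I ?\<Pi>f (deriv (u t)) = ?I (\<lambda>y. f (u t y)) (deriv (u t))"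
        using f_cont u deriv_Wh[OF u] by (rule L2_proj_compose)
      also have "\<dots> = (\<Sum>i=1..N. jump x N (\<lambda>y. V (u t y)) i)"
        using V_antideriv u by (rule mesh_inner_compose_deriv)
      finally show ?thesis by (simp add: sum_subtractf mult.commute)
    qed
    \<comment> \<open>Testing with \<open>q t\<close> itself makes the volume term cancel the
      average part of the trace.\<close>
    have "?I (q t) (p t) - \<epsilon> * \<tau>qu t * (\<Sum>i=1..N. jump x N (u t) i * jump x N (q t) i) =
        ?I (\<lambda>y. f (u t y)) (q t)"
      using p_weak[OF q] mesh_inner_deriv_self[OF q] by (simp add: mesh_inner_commute)
    \<comment> \<open>The third equation tested with \<open>u t\<close> and the first tested with
      \<open>p t\<close> share the terms that pair \<open>p t\<close> with
      \<open>deriv (u t)\<close> and its average with the jump of \<open>u t\<close>.\<close>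
    moreover have "?I U.wt (u t) = ?I (q t) (p t) - \<tau>pu t * (\<Sum>i=1..N. (jump x N (u t) i)\<^sup>2)"
      using u_weak[OF u] q_strong[OF p] mesh_inner_commute[of "deriv (u t)" "p t"]
      by (simp add: power2_eq_square mult.commute)
    ultimately have "?I U.wt (u t) = 0"
      using f_q tau1[OF t] by linarith
    moreover have "((\<lambda>s. mesh_integral x N (\<lambda>y. (u s y)\<^sup>2 * 1)) has_real_derivative
        mesh_integral x N (\<lambda>y. 2 * u t y * U.wt y * 1)) (at t within J)"
      by (rule U.has_derivative_mesh_integral[OF _ _ const_Wh])
         (auto intro!: derivative_eq_intros continuous_intros)
    moreover have "mesh_integral x N (\<lambda>y. 2 * u t y * U.wt y * 1) = 2 * ?I U.wt (u t)"
      by (simp add: mesh_inner_def mult_ac flip: mesh_integral_cmult)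
    ultimately show ?thesis by simp
  qed

  have hamiltonian: "((\<lambda>s. mesh_integral x N (\<lambda>y. \<epsilon> / 2 * (q s y)\<^sup>2 - V (u s y)))
      has_real_derivative 0) (at t within J)"
  proof -
    \<comment> \<open>The chain rule value of the derivative; the factors 1 are the constant weight
      in \<open>has_derivative_mesh_integral\<close>.\<close>
    let ?d = "mesh_integral x N (\<lambda>y. \<epsilon> * q t y * Q.wt y * 1)
      - mesh_integral x N (\<lambda>y. f (u t y) * U.wt y * 1)"
    have "((\<lambda>s. mesh_integral x N (\<lambda>y. \<epsilon> / 2 * (q s y)\<^sup>2 * 1) - mesh_integral x N (\<lambda>y. V (u s y) * 1))
        has_real_derivative ?d) (at t within J)"
    proof (rule DERIV_diff)
      show "((\<lambda>s. mesh_integral x N (\<lambda>y. \<epsilon> / 2 * (q s y)\<^sup>2 * 1)) has_real_derivative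
          mesh_integral x N (\<lambda>y. \<epsilon> * q t y * Q.wt y * 1)) (at t within J)"
        by (rule Q.has_derivative_mesh_integral[OF _ _ const_Wh])
           (auto intro!: derivative_eq_intros continuous_intros)
      show "((\<lambda>s. mesh_integral x N (\<lambda>y. V (u s y) * 1)) has_real_derivative
          mesh_integral x N (\<lambda>y. f (u t y) * U.wt y * 1)) (at t within J)"
        using V_antideriv f_cont const_Wh by (rule U.has_derivative_mesh_integral)
    qed
    then have deriv: "((\<lambda>s. mesh_integral x N (\<lambda>y. \<epsilon> / 2 * (q s y)\<^sup>2 - V (u s y)))
        has_real_derivative ?d) (at t within J)"
    proof (rule has_field_derivative_transform_within[OF _ zero_less_one t])
      fix s assume "s \<in> J"
      then show "mesh_integral x N (\<lambda>y. \<epsilon> / 2 * (q s y)\<^sup>2 * 1) - mesh_integral x N (\<lambda>y. V (u s y) * 1) =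
          mesh_integral x N (\<lambda>y. \<epsilon> / 2 * (q s y)\<^sup>2 - V (u s y))"
        using mesh_integral_diff_compose[of "\<lambda>z. \<epsilon> / 2 * z\<^sup>2" V "q s" k "u s" k] V_cont spaces
        by (simp add: continuous_intros)
    qed
    have "?d = \<epsilon> * ?I Q.wt (q t) - ?I (\<lambda>y. f (u t y)) U.wt"
      by (simp add: mesh_inner_def mult_ac flip: mesh_integral_cmult)
    moreover have "?I (\<lambda>y. f (u t y)) U.wt = ?I U.wt (p t) + \<epsilon> * ?I Q.wt (q t)
        - \<epsilon> * \<tau>qu t * (\<Sum>i=1..N. jump x N (u t) i * jump x N U.wt i)"
    proof -
      \<comment> \<open>Integration by parts moves the space derivative onto \<open>q t\<close>,
        where the time-differentiated first equation, tested with \<open>q t\<close>,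
        applies.\<close>
      have "?I (q t) (deriv U.wt) - (\<Sum>i=1..N. avg x N (q t) i * jump x N U.wt i) =
          ?I Q.wt (q t)"
        using mesh_integration_by_parts[OF q U.wt_Wh] qt_weak[OF q]
          mesh_inner_commute[of "deriv (q t)" U.wt]
        by (simp add: sum.distrib mult.commute)
      then have "\<epsilon> * ?I (q t) (deriv U.wt) - \<epsilon> * (\<Sum>i=1..N. avg x N (q t) i * jump x N U.wt i) =
          \<epsilon> * ?I Q.wt (q t)"
        by (simp flip: right_diff_distrib)
      then show ?thesis
        using p_weak[OF U.wt_Wh] mesh_inner_commute[of "p t" U.wt] by linarith
    qed
    moreover have "?I U.wt (p t) = - \<tau>pu t * (\<Sum>i=1..N. jump x N (p t) i * jump x N (u t) i)"
      using u_weak[OF p] mesh_inner_deriv_self[OF p] by (simp add: mult.commute)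
    \<comment> \<open>Time derivative and jump commute, which brings \<open>tau2\<close> into the
      form of the terms that are left.\<close>
    moreover have "\<tau>pu t * (\<Sum>i=1..N. jump x N (p t) i * jump x N (u t) i)
        + \<epsilon> * \<tau>qu t * (\<Sum>i=1..N. jump x N (u t) i * jump x N U.wt i) = 0"
      using tau2[OF t] by (simp add: U.tderiv_jump mult.commute)
    ultimately have "?d = 0" by simp
    then show ?thesis using deriv by simp
  qed

  show "((\<lambda>s. mesh_integral x N (u s)) has_real_derivative 0) (at t within J) \<and>
      ((\<lambda>s. mesh_integral x N (\<lambda>y. (u s y)\<^sup>2)) has_real_derivative 0) (at t within J) \<and>
      ((\<lambda>s. mesh_integral x N (\<lambda>y. \<epsilon> / 2 * (q s y)\<^sup>2 - V (u s y))) has_real_derivative 0)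
        (at t within J)"
    using mass energy hamiltonian by blast
qed

end
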